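(* For arbitrary positive frequencies $\nu_1,\dots,\nu_m$, let $\mathfrak g$ be the oscillator algebra, i.e. the real Lie algebra with basis $h,e_1,f_1,\dots,e_m,f_m,z$ and nonzero brackets $$[h,e_\ell]=\nu_\ell f_\ell,\qquad[h,f_\ell]=-\nu_\ell e_\ell,\qquad[e_\ell,f_\ell]=\nu_\ell z\qquad(1\le\ell\le m).$$ Let $V=\operatorname{span}\{e_\ell,f_\ell:1\le\ell\le m\}$. Then every solution $r\in\Lambda^2\mathfrak g$ of the classical Yang-Baxter equation $[r,r]=0$ has zero component in $h\wedge V$.
   Context: The bracket $[r,r]$ is the Schouten bracket, the symmetric bilinear map $\Lambda^2\mathfrak g\times\Lambda^2\mathfrak g\to\Lambda^3\mathfrak g$ with $[x\wedge y,u\wedge w]=[x,u]\wedge y\wedge w-[x,w]\wedge y\wedge u-[y,u]\wedge x\wedge w+[y,w]\wedge x\wedge u$. The component in $h\wedge V$ is taken with respect to the decomposition $\Lambda^2\mathfrak g=(h\wedge V)\oplus\Lambda^2V\oplus(z\wedge\mathfrak g)$. *)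

theory Defs
  imports "HOL-Analysis.Analysis"
begin

section \<open>Second and third exterior powers\<close>

text \<open>
  For the coordinate space \<open>\<real>\<^sup>I\<close> with a finite index type \<open>I\<close>, exterior powers are realised as spaces of
  skew-symmetric tensors, with \<open>x \<and> y = x \<otimes> y - y \<otimes> x\<close> and, in degree three, the signed sum over all
  six permutations.  No factorials occur, so basis elements wedge to tensors with entries \<open>0\<close>, \<open>1\<close>, \<open>-1\<close>.
\<close>

definition wedge2 :: "real^'i \<Rightarrow> real^'i \<Rightarrow> real^'i^'i" where
  "wedge2 x y = (\<chi> i j. x$i * y$j - y$i * x$j)"

definition wedge3 :: "real^'i \<Rightarrow> real^'i \<Rightarrow> real^'i \<Rightarrow> real^'i^'i^'i" where
  "wedge3 x y u = (\<chi> i j k.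
      x$i * y$j * u$k + y$i * u$j * x$k + u$i * x$j * y$k
    - x$i * u$j * y$k - y$i * x$j * u$k - u$i * y$j * x$k)"

definition wedge_span :: "(real^'i) set \<Rightarrow> (real^'i) set \<Rightarrow> (real^'i^'i) set" where
  "wedge_span A B = span {wedge2 a b | a b. a \<in> A \<and> b \<in> B}"

definition Lambda2 :: "(real^'i) set \<Rightarrow> (real^'i^'i) set" where
  "Lambda2 A = wedge_span A A"

definition Lambda3 :: "(real^'i) set \<Rightarrow> (real^'i^'i^'i) set" where
  "Lambda3 A = span {wedge3 a b c | a b c. a \<in> A \<and> b \<in> A \<and> c \<in> A}"

section \<open>The Schouten bracket\<close>

definition schouten_decomposable ::
  "(real^'i \<Rightarrow> real^'i \<Rightarrow> real^'i) \<Rightarrow> real^'i \<Rightarrow> real^'i \<Rightarrow> real^'i \<Rightarrow> real^'i \<Rightarrow> real^'i^'i^'i" where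
  "schouten_decomposable br x y u w =
     wedge3 (br x u) y w - wedge3 (br x w) y u - wedge3 (br y u) x w + wedge3 (br y w) x u"

text \<open>
  A skew-symmetric \<open>r\<close> equals \<open>1/2 \<Sum>\<^sub>i\<^sub>j r\<^sub>i\<^sub>j b\<^sub>i \<and> b\<^sub>j\<close> for the standard basis \<open>b\<close>, whence the factor
  \<open>1/4\<close> in the bilinear extension.  The lemmas \<open>schouten_wedge2\<close>, \<open>bilinear_schouten\<close> and
  \<open>schouten_unique\<close> below show that on \<open>Lambda2 UNIV\<close> this is the unique bilinear map with the prescribed
  values on decomposable elements.
\<close>

definition schouten ::
  "(real^'i \<Rightarrow> real^'i \<Rightarrow> real^'i) \<Rightarrow> real^'i^'i \<Rightarrow> real^'i^'i \<Rightarrow> real^'i^'i^'i" where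
  "schouten br r s = (1/4) *\<^sub>R (\<Sum>i\<in>UNIV. \<Sum>j\<in>UNIV. \<Sum>k\<in>UNIV. \<Sum>l\<in>UNIV.
      (r$i$j * s$k$l) *\<^sub>R schouten_decomposable br (axis i 1) (axis j 1) (axis k 1) (axis l 1))"

section \<open>The oscillator algebra\<close>

datatype 'n osc_index = IxH | IxE 'n | IxF 'n | IxZ

lemma UNIV_osc_index: "(UNIV :: 'n osc_index set) = {IxH, IxZ} \<union> range IxE \<union> range IxF"
proof -
  have "x \<in> {IxH, IxZ} \<union> range IxE \<union> range IxF" for x :: "'n osc_index"
    by (cases x) auto
  then show ?thesis by auto
qed

instance osc_index :: (finite) finite
  by standard (simp add: UNIV_osc_index)

type_synonym 'n osc = "real^('n osc_index)"

definition osc_h :: "'n::finite osc" where "osc_h = axis IxH 1"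
definition osc_e :: "'n::finite \<Rightarrow> 'n osc" where "osc_e l = axis (IxE l) 1"
definition osc_f :: "'n::finite \<Rightarrow> 'n osc" where "osc_f l = axis (IxF l) 1"
definition osc_z :: "'n::finite osc" where "osc_z = axis IxZ 1"

fun osc_basis_bracket :: "('n::finite \<Rightarrow> real) \<Rightarrow> 'n osc_index \<Rightarrow> 'n osc_index \<Rightarrow> 'n osc" where
  "osc_basis_bracket \<nu> IxH (IxE l) = \<nu> l *\<^sub>R osc_f l"
| "osc_basis_bracket \<nu> IxH (IxF l) = - (\<nu> l *\<^sub>R osc_e l)"
| "osc_basis_bracket \<nu> (IxE l) (IxF k) = (if l = k then \<nu> l *\<^sub>R osc_z else 0)"
| "osc_basis_bracket \<nu> (IxE l) IxH = - (\<nu> l *\<^sub>R osc_f l)"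
| "osc_basis_bracket \<nu> (IxF l) IxH = \<nu> l *\<^sub>R osc_e l"
| "osc_basis_bracket \<nu> (IxF k) (IxE l) = (if l = k then - (\<nu> l *\<^sub>R osc_z) else 0)"
| "osc_basis_bracket \<nu> _ _ = 0"

definition osc_bracket :: "('n::finite \<Rightarrow> real) \<Rightarrow> 'n osc \<Rightarrow> 'n osc \<Rightarrow> 'n osc" where
  "osc_bracket \<nu> x y = (\<Sum>i\<in>UNIV. \<Sum>j\<in>UNIV. (x$i * y$j) *\<^sub>R osc_basis_bracket \<nu> i j)"

definition osc_V :: "'n::finite osc set" where
  "osc_V = span (range osc_e \<union> range osc_f)"

text \<open>
  The component in \<open>h \<and> V\<close> with respect to \<open>\<Lambda>\<^sup>2\<gg> = (h \<and> V) \<oplus> \<Lambda>\<^sup>2V \<oplus> (z \<and> \<gg>)\<close>; see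
  \<open>Lambda2_decomposition\<close> for existence and uniqueness.
\<close>

definition hV_component :: "real^('n::finite osc_index)^('n osc_index) \<Rightarrow> real^('n osc_index)^('n osc_index)" where
  "hV_component r = (THE a. a \<in> wedge_span {osc_h} osc_V \<and>
      (\<exists>b \<in> Lambda2 osc_V. \<exists>c \<in> wedge_span {osc_z} UNIV. r = a + b + c))"

section \<open>Consistency of the definitions\<close>

lemma linear_sum_axis:
  fixes f :: "real^'i \<Rightarrow> 'b::real_vector"
  assumes "linear f"
  shows "f x = (\<Sum>i\<in>UNIV. x$i *\<^sub>R f (axis i 1))"
proof -
  have "f x = f (\<Sum>i\<in>UNIV. x$i *\<^sub>R axis i 1)"
    using basis_expansion[of x] by (simp add: scalar_mult_eq_scaleR)
  then show ?thesis
    by (simp add: linear_sum[OF assms] linear_cmul[OF assms])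
qed

lemma sum_sum_delta:
  fixes g :: "'a::finite \<Rightarrow> 'a \<Rightarrow> 'b::comm_monoid_add"
  shows "(\<Sum>i\<in>UNIV. \<Sum>j\<in>UNIV. if i = p then if j = q then g i j else 0 else 0) = g p q"
proof -
  have "(\<Sum>j\<in>UNIV. if i = p then if j = q then g i j else 0 else 0) = (if i = p then g i q else 0)" for i
    by simp
  then show ?thesis by simp
qed

lemma Lambda2_UNIV_iff: "r \<in> Lambda2 UNIV \<longleftrightarrow> (\<forall>i j. r$i$j = - (r$j$i))"
proof
  assume "r \<in> Lambda2 UNIV"
  then show "\<forall>i j. r$i$j = - (r$j$i)"
    unfolding Lambda2_def wedge_span_def
  proof (induction rule: span_induct_alt)
    case (step c x y)
    then obtain a b where x: "x = wedge2 a b" by auto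
    show ?case
    proof (intro allI)
      fix i j
      have y: "y$i$j = - (y$j$i)" using step by blast
      show "(c *\<^sub>R x + y)$i$j = - ((c *\<^sub>R x + y)$j$i)"
        unfolding x vector_add_component y by (simp add: wedge2_def algebra_simps)
    qed
  qed simp
next
  assume sk: "\<forall>i j. r$i$j = - (r$j$i)"
  have "r = (\<Sum>i\<in>UNIV. \<Sum>j\<in>UNIV. (r$i$j / 2) *\<^sub>R wedge2 (axis i 1) (axis j 1))" (is "_ = ?S")
  proof -
    have "?S $ p $ q = r $ p $ q" for p q
    proof -
      have "?S $ p $ q = (\<Sum>i\<in>UNIV. \<Sum>j\<in>UNIV.
          (if i = p then if j = q then r$i$j/2 else 0 else 0)
          - (if i = q then if j = p then r$i$j/2 else 0 else 0))"
        unfolding sum_component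
        by (intro sum.cong refl) (auto simp: wedge2_def axis_def)
      also have "\<dots> = r$p$q/2 - r$q$p/2"
        by (simp only: sum_subtractf sum_sum_delta)
      also have "\<dots> = r$p$q" using sk[rule_format, of q p] by simp
      finally show ?thesis .
    qed
    then show ?thesis by (simp add: vec_eq_iff)
  qed
  also have "\<dots> \<in> Lambda2 UNIV"
    unfolding Lambda2_def wedge_span_def
    by (intro span_sum span_scale span_base) auto
  finally show "r \<in> Lambda2 UNIV" .
qed

lemma bilinear_schouten: "bilinear (schouten br)"
  unfolding bilinear_def
proof (intro conjI allI linearI)
  show "schouten br (x + x') y = schouten br x y + schouten br x' y" "schouten br x (y + y') = schouten br x y + schouten br x y'" for x x' y y'
    by (simp_all add: schouten_def distrib_left distrib_right scaleR_add_left scaleR_add_right sum.distrib)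
  show "schouten br (c *\<^sub>R x) y = c *\<^sub>R schouten br x y" "schouten br x (c *\<^sub>R y) = c *\<^sub>R schouten br x y" for c x y
    by (simp_all add: schouten_def scaleR_sum_right mult_ac)
qed

lemma schouten_mem_Lambda3: "schouten br r s \<in> Lambda3 UNIV"
proof -
  have "wedge3 a b c \<in> Lambda3 UNIV" for a b c :: "real^'a"
    unfolding Lambda3_def by (intro span_base) auto
  then show ?thesis
    unfolding schouten_def schouten_decomposable_def Lambda3_def
    by (intro span_scale span_sum span_add span_diff)
qed

lemma schouten_decomposable_swap12:
  "schouten_decomposable br y x u w = - schouten_decomposable br x y u w"
  by (simp add: schouten_decomposable_def)

lemma schouten_decomposable_swap34:
  "schouten_decomposable br x y w u = - schouten_decomposable br x y u w"
  by (simp add: schouten_decomposable_def wedge3_def vec_eq_iff)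

lemma wedge3_linear:
  "wedge3 (x + x') y u = wedge3 x y u + wedge3 x' y u"
  "wedge3 x (y + y') u = wedge3 x y u + wedge3 x y' u"
  "wedge3 x y (u + u') = wedge3 x y u + wedge3 x y u'"
  "wedge3 (c *\<^sub>R x) y u = c *\<^sub>R wedge3 x y u"
  "wedge3 x (c *\<^sub>R y) u = c *\<^sub>R wedge3 x y u"
  "wedge3 x y (c *\<^sub>R u) = c *\<^sub>R wedge3 x y u"
  by (simp_all add: wedge3_def vec_eq_iff algebra_simps)

lemma schouten_decomposable_linear:
  assumes "bilinear br"
  shows "linear (\<lambda>x. schouten_decomposable br x y u w)"
    and "linear (\<lambda>u. schouten_decomposable br x y u w)"
    and "linear (\<lambda>y. schouten_decomposable br x y u w)"
    and "linear (\<lambda>w. schouten_decomposable br x y u w)"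
proof -
  note b = bilinear_ladd[OF assms] bilinear_radd[OF assms] bilinear_lmul[OF assms] bilinear_rmul[OF assms]
  show "linear (\<lambda>x. schouten_decomposable br x y u w)" "linear (\<lambda>u. schouten_decomposable br x y u w)"
    "linear (\<lambda>y. schouten_decomposable br x y u w)" "linear (\<lambda>w. schouten_decomposable br x y u w)"
    by (intro linearI; simp add: schouten_decomposable_def b wedge3_linear
        scaleR_diff_right scaleR_add_right)+
qed

lemma schouten_decomposable_expand:
  assumes "bilinear br"
  shows "schouten_decomposable br x y u w =
    (\<Sum>i\<in>UNIV. \<Sum>j\<in>UNIV. \<Sum>k\<in>UNIV. \<Sum>l\<in>UNIV. (x$i * y$j * u$k * w$l) *\<^sub>R
      schouten_decomposable br (axis i 1) (axis j 1) (axis k 1) (axis l 1))"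
proof -
  note L = schouten_decomposable_linear[OF assms]
  have "schouten_decomposable br x y u w = (\<Sum>i\<in>UNIV. x$i *\<^sub>R schouten_decomposable br (axis i 1) y u w)"
    by (rule linear_sum_axis[OF L(1)])
  also have "\<dots> = (\<Sum>i\<in>UNIV. x$i *\<^sub>R (\<Sum>j\<in>UNIV. y$j *\<^sub>R
      schouten_decomposable br (axis i 1) (axis j 1) u w))"
    by (intro sum.cong refl arg_cong[where f="scaleR _"] linear_sum_axis[OF L(3)])
  also have "\<dots> = (\<Sum>i\<in>UNIV. x$i *\<^sub>R (\<Sum>j\<in>UNIV. y$j *\<^sub>R (\<Sum>k\<in>UNIV. u$k *\<^sub>R
      schouten_decomposable br (axis i 1) (axis j 1) (axis k 1) w)))"
    by (intro sum.cong refl arg_cong[where f="scaleR _"] linear_sum_axis[OF L(2)])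
  also have "\<dots> = (\<Sum>i\<in>UNIV. x$i *\<^sub>R (\<Sum>j\<in>UNIV. y$j *\<^sub>R (\<Sum>k\<in>UNIV. u$k *\<^sub>R (\<Sum>l\<in>UNIV. w$l *\<^sub>R
      schouten_decomposable br (axis i 1) (axis j 1) (axis k 1) (axis l 1)))))"
    by (intro sum.cong refl arg_cong[where f="scaleR _"] linear_sum_axis[OF L(4)])
  finally show ?thesis
    by (simp add: scaleR_sum_right mult.assoc)
qed

lemma schouten_wedge2:
  assumes "bilinear br"
  shows "schouten br (wedge2 x y) (wedge2 u w) = schouten_decomposable br x y u w"
proof -
  let ?D = "schouten_decomposable br"
  let ?T = "\<lambda>x y u w. \<Sum>i\<in>UNIV. \<Sum>j\<in>UNIV. \<Sum>k\<in>UNIV. \<Sum>l\<in>UNIV. (x$i * y$j * u$k * w$l) *\<^sub>R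
      ?D (axis i 1) (axis j 1) (axis k 1) (axis l 1)"
  have "schouten br (wedge2 x y) (wedge2 u w) =
      (1/4) *\<^sub>R (?T x y u w - ?T y x u w - ?T x y w u + ?T y x w u)"
    unfolding schouten_def sum_subtractf[symmetric] sum.distrib[symmetric]
    by (intro sum.cong refl arg_cong[where f="scaleR _"])
      (simp add: wedge2_def algebra_simps flip: scaleR_add_left scaleR_diff_left)
  also have "\<dots> = (1/4) *\<^sub>R (?D x y u w - ?D y x u w - ?D x y w u + ?D y x w u)"
    by (simp only: schouten_decomposable_expand[OF assms, symmetric])
  also have "\<dots> = (1/4) *\<^sub>R (4 *\<^sub>R ?D x y u w)"
    by (simp only: schouten_decomposable_swap12[of br y x] schouten_decomposable_swap34[of br _ _ w u])
      (simp add: vec_eq_iff)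
  finally show ?thesis by simp
qed

lemma schouten_unique:
  assumes "bilinear br" and "bilinear B"
    and "\<And>x y u w. B (wedge2 x y) (wedge2 u w) = schouten_decomposable br x y u w"
    and "r \<in> Lambda2 UNIV" and "s \<in> Lambda2 UNIV"
  shows "B r s = schouten br r s"
  by (rule bilinear_eq[OF assms(2) bilinear_schouten subset_refl subset_refl,
        of r "{wedge2 a b | a b. a \<in> UNIV \<and> b \<in> UNIV}" s "{wedge2 a b | a b. a \<in> UNIV \<and> b \<in> UNIV}"])
    (use assms schouten_wedge2[OF assms(1)] in \<open>auto simp: Lambda2_def wedge_span_def\<close>)

lemma sum_osc_index:
  fixes g :: "'n::finite osc_index \<Rightarrow> 'b::comm_monoid_add"
  shows "(\<Sum>i\<in>UNIV. g i) = g IxH + g IxZ + (\<Sum>l\<in>UNIV. g (IxE l)) + (\<Sum>l\<in>UNIV. g (IxF l))"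
proof -
  have "(\<Sum>i\<in>UNIV. g i) = (\<Sum>i\<in>{IxH, IxZ}. g i) + (\<Sum>i\<in>range IxE. g i) + (\<Sum>i\<in>range IxF. g i)"
    unfolding UNIV_osc_index by (subst sum.union_disjoint; (subst sum.union_disjoint)?; auto)
  moreover have "(\<Sum>i\<in>range IxE. g i) = (\<Sum>l\<in>UNIV. g (IxE l))"
    by (subst sum.reindex) (auto simp: inj_on_def)
  moreover have "(\<Sum>i\<in>range IxF. g i) = (\<Sum>l\<in>UNIV. g (IxF l))"
    by (subst sum.reindex) (auto simp: inj_on_def)
  ultimately show ?thesis by simp
qed

lemma osc_bracket_nth:
  "osc_bracket \<nu> x y $ IxH = 0"
  "osc_bracket \<nu> x y $ IxE l = \<nu> l * (x$IxF l * y$IxH - x$IxH * y$IxF l)"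
  "osc_bracket \<nu> x y $ IxF l = \<nu> l * (x$IxH * y$IxE l - x$IxE l * y$IxH)"
  "osc_bracket \<nu> x y $ IxZ = (\<Sum>l\<in>UNIV. \<nu> l * (x$IxE l * y$IxF l - x$IxF l * y$IxE l))"
proof -
  have nth: "osc_bracket \<nu> x y $ p = (\<Sum>i\<in>UNIV. \<Sum>j\<in>UNIV. x$i * y$j * osc_basis_bracket \<nu> i j $ p)" for p
    by (simp add: osc_bracket_def)
  have if_nth: "(if b then v else w) $ p = (if b then v $ p else w $ p)" for b and v w :: "'a osc" and p
    by simp
  have mult_if: "c * (if b then u else 0) = (if b then c * u else 0)" for b and c u :: real
    by simp
  note simps = nth sum_osc_index osc_e_def osc_f_def osc_z_def axis_def if_nth mult_if
  show "osc_bracket \<nu> x y $ IxH = 0"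
    by (simp cong: if_cong add: simps)
  show "osc_bracket \<nu> x y $ IxE l = \<nu> l * (x$IxF l * y$IxH - x$IxH * y$IxF l)"
    by (simp cong: if_cong add: simps algebra_simps sum_negf)
  show "osc_bracket \<nu> x y $ IxF l = \<nu> l * (x$IxH * y$IxE l - x$IxE l * y$IxH)"
    by (simp cong: if_cong add: simps algebra_simps sum_negf)
  show "osc_bracket \<nu> x y $ IxZ = (\<Sum>l\<in>UNIV. \<nu> l * (x$IxE l * y$IxF l - x$IxF l * y$IxE l))"
    by (simp cong: if_cong add: simps algebra_simps sum_negf sum_subtractf)
qed

lemma bilinear_osc_bracket: "bilinear (osc_bracket \<nu>)"
  unfolding bilinear_def
proof (intro conjI allI linearI)
  show "osc_bracket \<nu> (x + x') y = osc_bracket \<nu> x y + osc_bracket \<nu> x' y" "osc_bracket \<nu> x (y + y') = osc_bracket \<nu> x y + osc_bracket \<nu> x y'" for x x' y y'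
    by (simp_all add: osc_bracket_def distrib_left distrib_right scaleR_add_left scaleR_add_right sum.distrib)
  show "osc_bracket \<nu> (c *\<^sub>R x) y = c *\<^sub>R osc_bracket \<nu> x y" "osc_bracket \<nu> x (c *\<^sub>R y) = c *\<^sub>R osc_bracket \<nu> x y" for c x y
    by (simp_all add: osc_bracket_def scaleR_sum_right mult_ac)
qed

lemma osc_eqI:
  assumes "x$IxH = y$IxH" "x$IxZ = y$IxZ" "\<And>l. x$IxE l = y$IxE l" "\<And>l. x$IxF l = y$IxF l"
  shows "x = (y::'n::finite osc)"
  unfolding vec_eq_iff using assms by (metis osc_index.exhaust)

lemma osc_bracket_self: "osc_bracket \<nu> x x = 0"
  by (rule osc_eqI) (simp_all add: osc_bracket_nth mult.commute)

lemma osc_bracket_Jacobi: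
  "osc_bracket \<nu> x (osc_bracket \<nu> y w) + osc_bracket \<nu> y (osc_bracket \<nu> w x)
     + osc_bracket \<nu> w (osc_bracket \<nu> x y) = 0"
proof (rule osc_eqI)
  show "(osc_bracket \<nu> x (osc_bracket \<nu> y w) + osc_bracket \<nu> y (osc_bracket \<nu> w x)
     + osc_bracket \<nu> w (osc_bracket \<nu> x y)) $ IxZ = 0 $ IxZ"
    unfolding vector_add_component osc_bracket_nth sum.distrib[symmetric] zero_index
    by (rule sum.neutral) (simp add: algebra_simps)
qed (simp_all add: osc_bracket_nth algebra_simps)

lemma osc_bracket_basis:
  "osc_bracket \<nu> (axis i 1) (axis j 1) = osc_basis_bracket \<nu> i j"
proof -
  have "osc_bracket \<nu> (axis i 1) (axis j 1) = (\<Sum>p\<in>UNIV. \<Sum>q\<in>UNIV.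
     if p = i then if q = j then osc_basis_bracket \<nu> p q else 0 else 0)"
    unfolding osc_bracket_def by (intro sum.cong refl) (auto simp: axis_def)
  then show ?thesis by (simp only: sum_sum_delta)
qed

lemma osc_V_iff: "v \<in> osc_V \<longleftrightarrow> v$IxH = 0 \<and> v$IxZ = 0"
proof
  assume "v \<in> osc_V"
  then show "v$IxH = 0 \<and> v$IxZ = 0"
    unfolding osc_V_def
    by (induction rule: span_induct_alt) (auto simp: osc_e_def osc_f_def axis_def)
next
  assume v: "v$IxH = 0 \<and> v$IxZ = 0"
  have "v = (\<Sum>i\<in>UNIV. v$i *\<^sub>R axis i 1)"
    using linear_sum_axis[OF linear_ident, of v] .
  also have "\<dots> = (\<Sum>l\<in>UNIV. v$IxE l *\<^sub>R osc_e l) + (\<Sum>l\<in>UNIV. v$IxF l *\<^sub>R osc_f l)"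
    using v by (simp add: sum_osc_index osc_e_def osc_f_def)
  also have "\<dots> \<in> osc_V"
    unfolding osc_V_def by (intro span_add span_sum span_scale span_base) auto
  finally show "v \<in> osc_V" .
qed

lemma wedge2_mem: "a \<in> A \<Longrightarrow> b \<in> B \<Longrightarrow> wedge2 a b \<in> wedge_span A B"
  unfolding wedge_span_def by (intro span_base) auto

lemma Lambda2_decomposition_exists:
  fixes r :: "real^('n::finite osc_index)^('n osc_index)"
  assumes "r \<in> Lambda2 UNIV"
  shows "\<exists>a\<in>wedge_span {osc_h} osc_V. \<exists>b\<in>Lambda2 osc_V. \<exists>c\<in>wedge_span {osc_z} UNIV. r = a + b + c"
  using assms unfolding Lambda2_def[of UNIV] wedge_span_def[of UNIV]
proof (induction rule: span_induct_alt)
  case base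
  show ?case by (auto simp: Lambda2_def wedge_span_def intro!: bexI[of _ 0] span_zero)
next
  case (step k t s)
  then obtain x y where t: "t = wedge2 x y" by auto
  from step obtain a b c where abc: "a\<in>wedge_span {osc_h} osc_V" "b\<in>Lambda2 osc_V"
    "c\<in>wedge_span {osc_z} UNIV" "s = a + b + c" by blast
  define v where "v = x - x$IxH *\<^sub>R osc_h - x$IxZ *\<^sub>R osc_z"
  define w where "w = y - y$IxH *\<^sub>R osc_h - y$IxZ *\<^sub>R osc_z"
  have v: "v \<in> osc_V" and w: "w \<in> osc_V"
    by (simp_all add: osc_V_iff v_def w_def osc_h_def osc_z_def axis_def)
  have dec: "t = wedge2 osc_h (x$IxH *\<^sub>R w - y$IxH *\<^sub>R v) + wedge2 v w
       + wedge2 osc_z (x$IxZ *\<^sub>R y - y$IxZ *\<^sub>R x)"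
    by (simp add: t v_def w_def wedge2_def vec_eq_iff algebra_simps)
  have m: "wedge2 osc_h (x$IxH *\<^sub>R w - y$IxH *\<^sub>R v) \<in> wedge_span {osc_h} osc_V"
     "wedge2 v w \<in> Lambda2 osc_V"
     "wedge2 osc_z (x$IxZ *\<^sub>R y - y$IxZ *\<^sub>R x) \<in> wedge_span {osc_z} UNIV"
    unfolding Lambda2_def using v w
    by (auto intro!: wedge2_mem simp: osc_V_iff)
  show ?case
    using m abc unfolding dec Lambda2_def wedge_span_def
    by (intro bexI[of _ "k *\<^sub>R wedge2 osc_h (x$IxH *\<^sub>R w - y$IxH *\<^sub>R v) + a"]
        bexI[of _ "k *\<^sub>R wedge2 v w + b"]
        bexI[of _ "k *\<^sub>R wedge2 osc_z (x$IxZ *\<^sub>R y - y$IxZ *\<^sub>R x) + c"] span_add span_scale)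
      (simp_all add: algebra_simps)
qed

lemma wedge_span_nth:
  "a \<in> wedge_span {osc_h} osc_V \<Longrightarrow> i \<noteq> IxH \<and> j \<noteq> IxH \<or> i = IxZ \<or> j = IxZ \<Longrightarrow> a$i$j = 0"
  "b \<in> Lambda2 osc_V \<Longrightarrow> i = IxH \<or> j = IxH \<or> i = IxZ \<or> j = IxZ \<Longrightarrow> b$i$j = 0"
  "c \<in> wedge_span {osc_z} UNIV \<Longrightarrow> i \<noteq> IxZ \<and> j \<noteq> IxZ \<Longrightarrow> c$i$j = 0"
proof -
  have *: "t$i$j = 0" if "t \<in> wedge_span A B" "\<And>x y. x \<in> A \<Longrightarrow> y \<in> B \<Longrightarrow> wedge2 x y $ i $ j = 0"
    for t :: "'a osc^('a osc_index)" and A B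
    using that(1) unfolding wedge_span_def
    by (induction rule: span_induct_alt) (auto simp: that(2))
  show "a \<in> wedge_span {osc_h} osc_V \<Longrightarrow> i \<noteq> IxH \<and> j \<noteq> IxH \<or> i = IxZ \<or> j = IxZ \<Longrightarrow> a$i$j = 0"
    by (erule *) (auto simp: wedge2_def osc_V_iff osc_h_def axis_def)
  show "b \<in> Lambda2 osc_V \<Longrightarrow> i = IxH \<or> j = IxH \<or> i = IxZ \<or> j = IxZ \<Longrightarrow> b$i$j = 0"
    unfolding Lambda2_def by (erule *) (auto simp: wedge2_def osc_V_iff)
  show "c \<in> wedge_span {osc_z} UNIV \<Longrightarrow> i \<noteq> IxZ \<and> j \<noteq> IxZ \<Longrightarrow> c$i$j = 0"
    by (erule *) (auto simp: wedge2_def osc_z_def axis_def)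
qed

lemma Lambda2_decomposition_unique:
  assumes "a \<in> wedge_span {osc_h} osc_V" "b \<in> Lambda2 osc_V" "c \<in> wedge_span {osc_z} UNIV"
    and "a' \<in> wedge_span {osc_h} osc_V" "b' \<in> Lambda2 osc_V" "c' \<in> wedge_span {osc_z} UNIV"
    and eq: "a + b + c = a' + b' + c'"
  shows "a = a'" "b = b'" "c = c'"
proof -
  have e: "a$i$j + b$i$j + c$i$j = a'$i$j + b'$i$j + c'$i$j" for i j
    using eq by (metis vector_add_component)
  note z = wedge_span_nth(1)[OF assms(1)] wedge_span_nth(2)[OF assms(2)] wedge_span_nth(3)[OF assms(3)]
    wedge_span_nth(1)[OF assms(4)] wedge_span_nth(2)[OF assms(5)] wedge_span_nth(3)[OF assms(6)]
  have "a$i$j = a'$i$j" for i j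
    using e[of i j] z[of i j] by (cases "i = IxZ \<or> j = IxZ"; cases "i = IxH \<or> j = IxH") auto
  then show a: "a = a'" by (simp add: vec_eq_iff)
  have "b$i$j = b'$i$j" for i j
    using e[of i j] z[of i j] by (cases "i = IxZ \<or> j = IxZ"; cases "i = IxH \<or> j = IxH") auto
  then show b: "b = b'" by (simp add: vec_eq_iff)
  show "c = c'" using eq a b by simp
qed

lemma Lambda2_decomposition:
  fixes r :: "real^('n::finite osc_index)^('n osc_index)"
  assumes "r \<in> Lambda2 UNIV"
  shows "\<exists>!(a, b, c). a \<in> wedge_span {osc_h} osc_V \<and> b \<in> Lambda2 osc_V \<and>
           c \<in> wedge_span {osc_z} UNIV \<and> r = a + b + c"
proof -
  obtain a b c where *: "a \<in> wedge_span {osc_h} osc_V" "b \<in> Lambda2 osc_V"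
      "c \<in> wedge_span {osc_z} UNIV" "r = a + b + c"
    using Lambda2_decomposition_exists[OF assms] by blast
  show ?thesis
  proof (rule ex1I[of _ "(a, b, c)"])
    show "case (a, b, c) of (a, b, c) \<Rightarrow> a \<in> wedge_span {osc_h} osc_V \<and> b \<in> Lambda2 osc_V \<and>
           c \<in> wedge_span {osc_z} UNIV \<and> r = a + b + c"
      using * by simp
  next
    fix t assume "case t of (a, b, c) \<Rightarrow> a \<in> wedge_span {osc_h} osc_V \<and> b \<in> Lambda2 osc_V \<and>
           c \<in> wedge_span {osc_z} UNIV \<and> r = a + b + c"
    then obtain a' b' c' where t: "t = (a', b', c')" "a' \<in> wedge_span {osc_h} osc_V" "b' \<in> Lambda2 osc_V"
        "c' \<in> wedge_span {osc_z} UNIV" "r = a' + b' + c'"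
      by (cases t) auto
    show "t = (a, b, c)"
      using Lambda2_decomposition_unique[OF t(2-4) *(1-3)] t(1,5) *(4) by simp
  qed
qed

lemma hV_component_eq:
  assumes "a \<in> wedge_span {osc_h} osc_V" "b \<in> Lambda2 osc_V" "c \<in> wedge_span {osc_z} UNIV"
  shows "hV_component (a + b + c) = a"
  unfolding hV_component_def
proof (rule the_equality)
  show "a \<in> wedge_span {osc_h} osc_V \<and>
      (\<exists>b'\<in>Lambda2 osc_V. \<exists>c'\<in>wedge_span {osc_z} UNIV. a + b + c = a + b' + c')"
    using assms by blast
next
  fix a' assume "a' \<in> wedge_span {osc_h} osc_V \<and>
      (\<exists>b'\<in>Lambda2 osc_V. \<exists>c'\<in>wedge_span {osc_z} UNIV. a + b + c = a' + b' + c')"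
  then obtain b' c' where "a' \<in> wedge_span {osc_h} osc_V" "b' \<in> Lambda2 osc_V"
      "c' \<in> wedge_span {osc_z} UNIV" "a + b + c = a' + b' + c'"
    by blast
  from Lambda2_decomposition_unique(1)[OF assms this] show "a' = a" by simp
qed

end

theory Submission
  imports Defs
begin

text \<open>
  Let \<open>v = \<Sum>\<^sub>l (a\<^sub>l e\<^sub>l + b\<^sub>l f\<^sub>l)\<close>, where \<open>h \<and> v\<close> is the component of \<open>r\<close> in \<open>h \<and> V\<close>, and let \<open>J\<close> be the
  restriction of \<open>ad h\<close> to \<open>V\<close>.  No bracket in the oscillator algebra has an \<open>h\<close>-part, and the
  \<open>V\<close>-part of a bracket only arises from \<open>ad h\<close>.  Hence the part of \<open>[r, r]\<close> in \<open>h \<and> \<Lambda>\<^sup>2V\<close> sees nothing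
  of \<open>r\<close> but \<open>v\<close>: it is a nonzero multiple of \<open>h \<and> v \<and> J v\<close>.  So the Yang-Baxter equation
  forces \<open>v\<close> and \<open>J v\<close> to be parallel.  Since \<open>J\<close> rotates each plane \<open>\<langle>e\<^sub>l, f\<^sub>l\<rangle>\<close> by a quarter turn and
  scales it by \<open>\<nu>\<^sub>l > 0\<close>, this is possible only for \<open>v = 0\<close>.

  In coordinates it suffices to read off the coefficient of \<open>h \<and> e\<^sub>l \<and> f\<^sub>l\<close>, which is
  \<open>2 \<nu>\<^sub>l (a\<^sub>l\<^sup>2 + b\<^sub>l\<^sup>2)\<close> (lemma \<open>schouten_osc_bracket_nth_HEF\<close>).  It is obtained from a formula for the
  entries of a Schouten bracket in terms of brackets of the columns of the two tensors
  (lemma \<open>schouten_nth\<close>), the coordinate form of the pairing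
  \<open>[r, r](\<alpha>, \<beta>, \<gamma>) = 2 (\<alpha>[r\<beta>, r\<gamma>] + \<beta>[r\<gamma>, r\<alpha>] + \<gamma>[r\<alpha>, r\<beta>])\<close>.
\<close>

lemma bilinear_sum_axis:
  fixes br :: "real^'i \<Rightarrow> real^'j \<Rightarrow> 'b::real_vector"
  assumes "bilinear br"
  shows "br x y = (\<Sum>i\<in>UNIV. \<Sum>k\<in>UNIV. (x$i * y$k) *\<^sub>R br (axis i 1) (axis k 1))"
proof -
  have "br x y = (\<Sum>i\<in>UNIV. x$i *\<^sub>R br (axis i 1) y)"
    using assms by (intro linear_sum_axis) (simp add: bilinear_def)
  also have "\<dots> = (\<Sum>i\<in>UNIV. x$i *\<^sub>R (\<Sum>k\<in>UNIV. y$k *\<^sub>R br (axis i 1) (axis k 1)))"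
    using assms
    by (intro sum.cong refl arg_cong[where f="scaleR _"] linear_sum_axis) (simp add: bilinear_def)
  finally show ?thesis
    by (simp add: scaleR_sum_right)
qed

text \<open>
  The four terms of the bracket of decomposables differ only by exchanging the two factors within
  \<open>r\<close> or within \<open>s\<close>, so skew-symmetry makes their sums equal and absorbs the normalising factor \<open>1/4\<close>.
\<close>

lemma schouten_skew:
  fixes br :: "real^'i \<Rightarrow> real^'i \<Rightarrow> real^'i"
  assumes "r \<in> Lambda2 UNIV" and "s \<in> Lambda2 UNIV"
  shows "schouten br r s = (\<Sum>i\<in>UNIV. \<Sum>j\<in>UNIV. \<Sum>k\<in>UNIV. \<Sum>l\<in>UNIV.
    (r$i$j * s$k$l) *\<^sub>R wedge3 (br (axis i 1) (axis k 1)) (axis j 1) (axis l 1))"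
proof -
  define W where "W i j k l = wedge3 (br (axis i 1) (axis k 1)) (axis j 1) (axis l 1)" for i j k l
  define S where "S G = (\<Sum>i\<in>UNIV. \<Sum>j\<in>UNIV. \<Sum>k\<in>UNIV. \<Sum>l\<in>UNIV. (r$i$j * s$k$l) *\<^sub>R G i j k l)"
    for G :: "'i \<Rightarrow> 'i \<Rightarrow> 'i \<Rightarrow> 'i \<Rightarrow> real^'i^'i^'i"
  have skr: "r$j$i = - (r$i$j)" and sks: "s$j$i = - (s$i$j)" for i j
    using assms unfolding Lambda2_UNIV_iff by blast+
  have swap_s: "S (\<lambda>i j k l. G i j l k) = - S G" for G
  proof -
    have "(\<Sum>k\<in>UNIV. \<Sum>l\<in>UNIV. (r$i$j * s$k$l) *\<^sub>R G i j l k)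
        = - (\<Sum>k\<in>UNIV. \<Sum>l\<in>UNIV. (r$i$j * s$k$l) *\<^sub>R G i j k l)" for i j
      by (subst sum.swap, subst sks) (simp add: sum_negf)
    then show ?thesis by (simp add: S_def sum_negf)
  qed
  have swap_r: "S (\<lambda>i j k l. G j i k l) = - S G" for G
    unfolding S_def by (subst sum.swap, subst skr) (simp add: sum_negf)
  have "schouten br r s = (1/4) *\<^sub>R (S W - S (\<lambda>i j k l. W i j l k) - S (\<lambda>i j k l. W j i k l)
      + S (\<lambda>i j k l. W j i l k))"
    by (simp add: schouten_def schouten_decomposable_def S_def W_def
        scaleR_diff_right scaleR_add_right sum.distrib sum_subtractf)
  also have "\<dots> = (1/4) *\<^sub>R (4 *\<^sub>R S W)"
    using swap_s[of W] swap_r[of W] swap_r[of "\<lambda>i j k l. W i j l k"]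
    by (simp add: vec_eq_iff)
  finally show ?thesis by (simp add: S_def W_def)
qed

text \<open>
  Contracting two legs of the tensor product of \<open>r\<close> and \<open>s\<close> with coordinate functionals leaves the
  bracket of a column of \<open>r\<close> with a column of \<open>s\<close>; the six terms are the six permutations in \<open>wedge3\<close>.
\<close>

lemma schouten_nth:
  fixes br :: "real^'i \<Rightarrow> real^'i \<Rightarrow> real^'i"
  assumes br: "bilinear br" and "r \<in> Lambda2 UNIV" and "s \<in> Lambda2 UNIV"
  shows "schouten br r s $ p $ q $ t =
      br (column q r) (column t s) $ p + br (column p r) (column q s) $ t
    + br (column t r) (column p s) $ q - br (column t r) (column q s) $ p
    - br (column p r) (column t s) $ q - br (column q r) (column p s) $ t"
proof -
  define S where "S G = (\<Sum>i\<in>UNIV. \<Sum>j\<in>UNIV. \<Sum>k\<in>UNIV. \<Sum>l\<in>UNIV. (r$i$j * s$k$l) * G i j k l)"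
    for G :: "'i \<Rightarrow> 'i \<Rightarrow> 'i \<Rightarrow> 'i \<Rightarrow> real"
  have contract: "S (\<lambda>i j k l. br (axis i 1) (axis k 1) $ a * axis j 1 $ b * axis l 1 $ c)
      = br (column b r) (column c s) $ a" (is "S ?G = _") for a b c
  proof -
    have "S ?G = (\<Sum>i\<in>UNIV. \<Sum>k\<in>UNIV. \<Sum>j\<in>UNIV. \<Sum>l\<in>UNIV. (r$i$j * s$k$l) * ?G i j k l)"
      unfolding S_def by (intro sum.cong refl sum.swap)
    also have "\<dots> = (\<Sum>i\<in>UNIV. \<Sum>k\<in>UNIV. \<Sum>j\<in>UNIV. \<Sum>l\<in>UNIV.
        if j = b then if l = c then r$i$j * s$k$l * br (axis i 1) (axis k 1) $ a else 0 else 0)"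
      by (intro sum.cong refl) (auto simp: axis_def)
    also have "\<dots> = (\<Sum>i\<in>UNIV. \<Sum>k\<in>UNIV. r$i$b * s$k$c * br (axis i 1) (axis k 1) $ a)"
      by (simp only: sum_sum_delta)
    also have "\<dots> = br (column b r) (column c s) $ a"
      by (subst bilinear_sum_axis[OF br]) (simp add: column_def)
    finally show ?thesis .
  qed
  let ?x = "\<lambda>a i k. br (axis i 1) (axis k 1) $ a"
  let ?e = "\<lambda>a j. axis j 1 $ a :: real"
  have "schouten br r s $ p $ q $ t = S (\<lambda>i j k l.
        ?x p i k * ?e q j * ?e t l + ?x t i k * ?e p j * ?e q l + ?x q i k * ?e t j * ?e p l
      - ?x p i k * ?e t j * ?e q l - ?x q i k * ?e p j * ?e t l - ?x t i k * ?e q j * ?e p l)"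
    unfolding schouten_skew[OF assms(2,3)] S_def
    by (simp add: wedge3_def mult_ac)
  also have "\<dots> = S (\<lambda>i j k l. ?x p i k * ?e q j * ?e t l) + S (\<lambda>i j k l. ?x t i k * ?e p j * ?e q l)
      + S (\<lambda>i j k l. ?x q i k * ?e t j * ?e p l) - S (\<lambda>i j k l. ?x p i k * ?e t j * ?e q l)
      - S (\<lambda>i j k l. ?x q i k * ?e p j * ?e t l) - S (\<lambda>i j k l. ?x t i k * ?e q j * ?e p l)"
    by (simp only: S_def distrib_left right_diff_distrib sum.distrib sum_subtractf)
  finally show ?thesis by (simp only: contract)
qed

text \<open>
  Every bracket that contributes has the column of \<open>h\<close> as one argument, because brackets have no
  \<open>h\<close>-part; its \<open>e\<^sub>l\<close>- and \<open>f\<^sub>l\<close>-parts involve only the entries of \<open>r\<close> at \<open>h \<and> e\<^sub>l\<close> and \<open>h \<and> f\<^sub>l\<close>.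
\<close>

lemma schouten_osc_bracket_nth_HEF:
  assumes "r \<in> Lambda2 UNIV"
  shows "schouten (osc_bracket \<nu>) r r $ IxH $ IxE l $ IxF l
    = 2 * \<nu> l * ((r $ IxH $ IxE l)\<^sup>2 + (r $ IxH $ IxF l)\<^sup>2)"
proof -
  have sk: "r$i$j = - (r$j$i)" for i j
    using assms unfolding Lambda2_UNIV_iff by blast
  have "r $ IxH $ IxH = 0" "r $ IxE l $ IxH = - (r $ IxH $ IxE l)"
    "r $ IxF l $ IxH = - (r $ IxH $ IxF l)"
    using sk[of IxH IxH] sk[of "IxE l" IxH] sk[of "IxF l" IxH] by simp_all
  then show ?thesis
    by (simp add: schouten_nth[OF bilinear_osc_bracket assms assms] osc_bracket_nth column_def
        power2_eq_square algebra_simps)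
qed

lemma hV_component_eq_0:
  fixes r :: "real^('n::finite osc_index)^('n osc_index)"
  assumes r: "r \<in> Lambda2 UNIV"
    and "\<And>l. r $ IxH $ IxE l = 0" "\<And>l. r $ IxH $ IxF l = 0"
  shows "hV_component r = 0"
proof -
  obtain a b c where a: "a \<in> wedge_span {osc_h} osc_V" and b: "b \<in> Lambda2 osc_V"
    and c: "c \<in> wedge_span {osc_z} UNIV" and abc: "r = a + b + c"
    using Lambda2_decomposition_exists[OF r] by blast
  have sk: "r$i$j = - (r$j$i)" for i j
    using r unfolding Lambda2_UNIV_iff by blast
  have rH: "r$IxH$j = 0" if "j \<noteq> IxZ" for j
    using assms(2,3) sk[of IxH IxH] that by (cases j) auto
  have "a$i$j = 0" for i j
  proof (cases "i \<noteq> IxH \<and> j \<noteq> IxH \<or> i = IxZ \<or> j = IxZ")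
    case True
    then show ?thesis by (rule wedge_span_nth(1)[OF a])
  next
    case False
    have "a$i$j = r$i$j"
      using wedge_span_nth(2)[OF b, of i j] wedge_span_nth(3)[OF c, of i j] False
      by (auto simp: abc)
    also have "\<dots> = 0"
      using False rH sk[of i j] by auto
    finally show ?thesis .
  qed
  then have "a = 0" by (simp add: vec_eq_iff)
  then show ?thesis using hV_component_eq[OF a b c] abc by simp
qed

theorem proposition6p4:
  fixes \<nu> :: "'n::finite \<Rightarrow> real"
    and r :: "real^('n osc_index)^('n osc_index)"
  assumes "\<And>l. \<nu> l > 0"
    and "r \<in> Lambda2 UNIV"
    and "schouten (osc_bracket \<nu>) r r = 0"
  shows "hV_component r = 0"
proof -
  have "(r $ IxH $ IxE l)\<^sup>2 + (r $ IxH $ IxF l)\<^sup>2 = 0" for l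
    using schouten_osc_bracket_nth_HEF[OF assms(2), of \<nu> l] assms(1)[of l] assms(3) by simp
  then show ?thesis
    by (intro hV_component_eq_0 assms(2)) (simp_all add: sum_power2_eq_zero_iff)
qed

end
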